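(* Let $G=(V,E)$ be an infinite, connected, locally finite graph, and let $P=\Delta_{1,a}+W$ be a Schrödinger operator on $G$ (with $a:E\to\mathbb{R}_+^\star$ and $W:V\to\mathbb{R}$). Assume that $$\langle Pf,f\rangle_{l^2}>0\qquad\text{for every } f\in C_0(V)\setminus\{0\}.$$ Then there exist a vertex weight $\omega:V\to\mathbb{R}_+^\star$ and an edge conductance $c:E\to\mathbb{R}_+^\star$ such that the operator $P$ is unitarily equivalent to the weighted graph Laplacian $\Delta_{\omega,c}$ on $G$.
   Context: $G=(V,E)$ is a graph with vertex set $V$ and edge set $E$, whose edges are unordered pairs $\{x,y\}$ of distinct vertices; $x\sim y$ means $\{x,y\}\in E$. $\mathbb{R}_+^\star=(0,\infty)$. A function $a$ on $E$ is written $a_{x,y}=a_{y,x}$ for $\{x,y\}\in E$. $C_0(V)$ is the space of finitely supported functions $V\to\mathbb{R}$. For $\omega:V\to\mathbb{R}_+^\star$, $l^2_\omega(V)=\{f:V\to\mathbb{R}:\sum_{x\in V}\omega_x^2|f(x)|^2<\infty\}$ is a Hilbert space with scalar product $\langle f,g\rangle_{l^2_\omega}=\sum_{x\in V}\omega_x^2f(x)g(x)$; $l^2(V)$ is the case $\omega\equiv1$. The weighted graph Laplacian is $(\Delta_{\omega,c}f)(x)=\frac{1}{\omega_x^2}\sum_{y\sim x}c_{x,y}(f(x)-f(y))$, and the Schrödinger operator is $((\Delta_{1,a}+W)f)(x)=\sum_{y\sim x}a_{x,y}(f(x)-f(y))+W(x)f(x)$. Both are considered as operators with domain $C_0(V)$,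 in $l^2_\omega(V)$ and $l^2(V)$ respectively. Unitary equivalence of $P$ and $\Delta_{\omega,c}$ means that there is a unitary map $U:l^2(V)\to l^2_\omega(V)$ with $U(C_0(V))=C_0(V)$ and $P=U^{-1}\Delta_{\omega,c}U$ on $C_0(V)$. *)

theory Defs
  imports "HOL-Analysis.Analysis"
begin

text \<open>The vertex set is the whole type \<open>'v\<close>, so a function on \<open>V\<close> is a function on \<open>'v\<close>. A function
  on edges is a function of the unordered pair, hence \<open>a {x, y} = a {y, x}\<close> by construction; its
  values on sets that are not edges are irrelevant.\<close>

definition graph_edges :: "'v set set \<Rightarrow> bool" where
  "graph_edges E \<longleftrightarrow> (\<forall>e\<in>E. \<exists>x y. x \<noteq> y \<and> e = {x, y})"

definition neighbours :: "'v set set \<Rightarrow> 'v \<Rightarrow> 'v set" where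
  "neighbours E x = {y. {x, y} \<in> E}"

definition graph_locally_finite :: "'v set set \<Rightarrow> bool" where
  "graph_locally_finite E \<longleftrightarrow> (\<forall>x. finite (neighbours E x))"

definition graph_connected :: "'v set set \<Rightarrow> bool" where
  "graph_connected E \<longleftrightarrow> (\<forall>x y. (x, y) \<in> {(u, v). {u, v} \<in> E}\<^sup>*)"

definition C0 :: "('v \<Rightarrow> real) set" where
  "C0 = {f. finite {x. f x \<noteq> 0}}"

definition l2 :: "('v \<Rightarrow> real) \<Rightarrow> ('v \<Rightarrow> real) set" where
  "l2 \<omega> = {f. (\<lambda>x. (\<omega> x)\<^sup>2 * \<bar>f x\<bar>\<^sup>2) summable_on UNIV}"

definition l2_inner :: "('v \<Rightarrow> real) \<Rightarrow> ('v \<Rightarrow> real) \<Rightarrow> ('v \<Rightarrow> real) \<Rightarrow> real" where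
  "l2_inner \<omega> f g = (\<Sum>\<^sub>\<infinity>x. (\<omega> x)\<^sup>2 * f x * g x)"

definition weighted_laplacian ::
  "'v set set \<Rightarrow> ('v \<Rightarrow> real) \<Rightarrow> ('v set \<Rightarrow> real) \<Rightarrow> ('v \<Rightarrow> real) \<Rightarrow> 'v \<Rightarrow> real" where
  "weighted_laplacian E \<omega> c f x =
     1 / (\<omega> x)\<^sup>2 * (\<Sum>y\<in>neighbours E x. c {x, y} * (f x - f y))"

definition schroedinger ::
  "'v set set \<Rightarrow> ('v set \<Rightarrow> real) \<Rightarrow> ('v \<Rightarrow> real) \<Rightarrow> ('v \<Rightarrow> real) \<Rightarrow> 'v \<Rightarrow> real" where
  "schroedinger E a W f x = weighted_laplacian E (\<lambda>_. 1) a f x + W x * f x"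

text \<open>Unitary means surjective, linear and preserving the scalar product. Only the restriction of
  \<open>U\<close> to its domain \<open>l2 \<eta>\<close> is constrained.\<close>

definition unitary_map ::
  "('v \<Rightarrow> real) \<Rightarrow> ('v \<Rightarrow> real) \<Rightarrow> (('v \<Rightarrow> real) \<Rightarrow> ('v \<Rightarrow> real)) \<Rightarrow> bool" where
  "unitary_map \<eta> \<omega> U \<longleftrightarrow>
     bij_betw U (l2 \<eta>) (l2 \<omega>) \<and>
     (\<forall>f\<in>l2 \<eta>. \<forall>g\<in>l2 \<eta>. U (\<lambda>x. f x + g x) = (\<lambda>x. U f x + U g x)) \<and>
     (\<forall>r. \<forall>f\<in>l2 \<eta>. U (\<lambda>x. r * f x) = (\<lambda>x. r * U f x)) \<and>
     (\<forall>f\<in>l2 \<eta>. \<forall>g\<in>l2 \<eta>. l2_inner \<omega> (U f) (U g) = l2_inner \<eta> f g)"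

text \<open>\<open>P\<close> and \<open>Q\<close> are operators with domain \<open>C0\<close> in \<open>l2 \<eta>\<close> and \<open>l2 \<omega>\<close>; their values on other
  functions play no role.\<close>

definition unitarily_equivalent ::
  "('v \<Rightarrow> real) \<Rightarrow> (('v \<Rightarrow> real) \<Rightarrow> ('v \<Rightarrow> real)) \<Rightarrow>
   ('v \<Rightarrow> real) \<Rightarrow> (('v \<Rightarrow> real) \<Rightarrow> ('v \<Rightarrow> real)) \<Rightarrow> bool" where
  "unitarily_equivalent \<eta> P \<omega> Q \<longleftrightarrow>
     (\<exists>U. unitary_map \<eta> \<omega> U \<and> U ` C0 = C0 \<and>
          (\<forall>f\<in>C0. P f = inv_into (l2 \<eta>) U (Q (U f))))"

end

theory Submission
  imports Defs
begin

text \<open>If \<open>\<phi> > 0\<close> satisfies \<open>P \<phi> = 0\<close>, then \<open>\<omega> = \<phi>\<close>, \<open>c\<^sub>x\<^sub>y = a\<^sub>x\<^sub>y \<phi>\<^sub>x \<phi>\<^sub>y\<close> and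
  \<open>U f = f / \<phi>\<close> do the job. To find \<open>\<phi>\<close>, one solves, for each finite \<open>K\<close>, the problem \<open>P u = 0\<close> on
  \<open>K\<close> with \<open>u = 1\<close> off \<open>K\<close>; positivity of the form makes it solvable with \<open>u \<ge> 0\<close> (eliminate the
  vertices of \<open>K\<close> one at a time). Where \<open>P u = 0\<close> and \<open>u \<ge> 0\<close>, the value of \<open>u\<close> at a vertex controls
  its values at the neighbours, so that the solutions normalised at a base vertex are eventually
  bounded at every vertex, and a compactness argument yields \<open>\<phi>\<close>.\<close>

section \<open>Weighted l2 spaces and division by the weight\<close>

lemma C0_subset_l2: "C0 \<subseteq> l2 \<omega>"
proof
  fix f :: "'a \<Rightarrow> real"
  assume "f \<in> C0"
  then have "(\<lambda>x. (\<omega> x)\<^sup>2 * \<bar>f x\<bar>\<^sup>2) summable_on {x. f x \<noteq> 0}"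
    by (simp add: C0_def)
  then show "f \<in> l2 \<omega>"
    unfolding l2_def mem_Collect_eq
    by (rule summable_on_cong_neutral[THEN iffD1, rotated -1]) auto
qed

lemma l2_inner_finite:
  assumes "finite K" and "\<And>x. x \<notin> K \<Longrightarrow> g x = 0"
  shows "l2_inner \<omega> f g = (\<Sum>x\<in>K. (\<omega> x)\<^sup>2 * f x * g x)"
proof -
  have "l2_inner \<omega> f g = (\<Sum>\<^sub>\<infinity>x\<in>K. (\<omega> x)\<^sup>2 * f x * g x)"
    unfolding l2_inner_def by (rule infsum_cong_neutral) (use assms in auto)
  then show ?thesis
    using assms by simp
qed

text \<open>The two factors \<open>1 / \<omega> x\<close> in a scalar product cancel the weight
  \<open>(\<omega> x)\<^sup>2\<close>; multiplication by \<open>\<omega>\<close> is the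
  inverse.\<close>

lemma unitary_map_divide:
  assumes "\<And>x. \<omega> x > 0"
  shows "unitary_map (\<lambda>_. 1) \<omega> (\<lambda>f x. f x / \<omega> x)"
proof -
  have nz: "\<omega> x \<noteq> 0" for x
    using assms[of x] by simp
  have "bij_betw (\<lambda>f x. f x / \<omega> x) (l2 (\<lambda>_. 1)) (l2 \<omega>)"
    by (rule bij_betw_byWitness[where f' = "\<lambda>f x. \<omega> x * f x"])
       (auto simp: nz l2_def abs_mult power_mult_distrib power_divide)
  moreover have "l2_inner \<omega> (\<lambda>x. f x / \<omega> x) (\<lambda>x. g x / \<omega> x) = l2_inner (\<lambda>_. 1) f g" for f g
    unfolding l2_inner_def by (rule infsum_cong) (simp add: nz power2_eq_square)
  ultimately show ?thesis
    by (simp add: unitary_map_def add_divide_distrib)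
qed

section \<open>Adjacency and connectedness\<close>

lemma not_loop:
  assumes "graph_edges E"
  shows "{x} \<notin> E"
  using assms by (auto simp: graph_edges_def doubleton_eq_iff)

lemma neighbours_sym: "y \<in> neighbours E x \<longleftrightarrow> x \<in> neighbours E y"
  by (simp add: neighbours_def insert_commute)

text \<open>Induction along a path. It later propagates the Harnack bound and the vanishing of a
  function from one vertex to all.\<close>

lemma connected_closed_mem:
  assumes "graph_connected E" and "x \<in> S" and "\<And>y. y \<in> S \<Longrightarrow> neighbours E y \<subseteq> S"
  shows "y \<in> S"
proof -
  have "(x, y) \<in> {(u, v). {u, v} \<in> E}\<^sup>*"
    using assms(1) by (simp add: graph_connected_def)
  then show ?thesis
    by induction (use assms(2,3) in \<open>auto simp: neighbours_def\<close>)
qed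

section \<open>The operator as a matrix, and its quadratic form\<close>

locale positive_schroedinger =
  fixes E :: "'v set set" and a :: "'v set \<Rightarrow> real" and W :: "'v \<Rightarrow> real"
  assumes edges: "graph_edges E"
    and infinite_V: "infinite (UNIV :: 'v set)"
    and conn: "graph_connected E"
    and loc_fin: "graph_locally_finite E"
    and a_pos: "\<forall>e\<in>E. a e > 0"
    and form_pos: "\<forall>f\<in>C0 - {\<lambda>_. 0}. l2_inner (\<lambda>_. 1) (schroedinger E a W f) f > 0"
begin

abbreviation P :: "('v \<Rightarrow> real) \<Rightarrow> 'v \<Rightarrow> real" where
  "P \<equiv> schroedinger E a W"

text \<open>The diagonal matrix entry of \<open>P\<close>; the off-diagonal entries are
  \<open>- a {x, y}\<close> on edges, hence negative.\<close>

definition diag :: "'v \<Rightarrow> real" where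
  "diag x = W x + (\<Sum>y\<in>neighbours E x. a {x, y})"

lemma finite_neighbours [simp]: "finite (neighbours E x)"
  using loc_fin by (simp add: graph_locally_finite_def)

lemma a_edge_pos: "y \<in> neighbours E x \<Longrightarrow> a {x, y} > 0"
  using a_pos by (simp add: neighbours_def)

lemma P_eq: "P f x = diag x * f x - (\<Sum>y\<in>neighbours E x. a {x, y} * f y)"
  by (simp add: schroedinger_def weighted_laplacian_def diag_def right_diff_distrib
      sum_subtractf distrib_right sum_distrib_right)

lemma P_add: "P (\<lambda>x. f x + g x) x = P f x + P g x"
  by (simp add: P_eq algebra_simps sum.distrib)

lemma P_scale: "P (\<lambda>x. r * f x) x = r * P f x"
  by (simp add: P_eq algebra_simps sum_distrib_left)

lemma P_C0:
  assumes "f \<in> C0"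
  shows "P f \<in> C0"
proof -
  have "{x. P f x \<noteq> 0} \<subseteq> {x. f x \<noteq> 0} \<union> (\<Union>y\<in>{x. f x \<noteq> 0}. neighbours E y)"
  proof
    fix x assume x: "x \<in> {x. P f x \<noteq> 0}"
    show "x \<in> {x. f x \<noteq> 0} \<union> (\<Union>y\<in>{x. f x \<noteq> 0}. neighbours E y)"
    proof (rule ccontr)
      assume "\<not> ?thesis"
      then have "f x = 0" and "\<And>y. y \<in> neighbours E x \<Longrightarrow> f y = 0"
        using neighbours_sym[of _ E x] by auto
      then have "P f x = 0"
        by (simp add: P_eq)
      with x show False
        by simp
    qed
  qed
  moreover have "finite \<dots>"
    using assms by (simp add: C0_def)
  ultimately show ?thesis
    unfolding C0_def mem_Collect_eq by (rule finite_subset)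
qed

text \<open>At a zero of \<open>f\<close> the diagonal term drops out, and the off-diagonal entries
  are negative.\<close>

lemma P_nonpos:
  assumes "f x = 0" and "\<And>y. f y \<ge> 0"
  shows "P f x \<le> 0"
  using assms by (auto simp: P_eq intro!: sum_nonneg mult_nonneg_nonneg less_imp_le[OF a_edge_pos])

lemma P_form_pos:
  assumes "finite K" and "\<And>x. x \<notin> K \<Longrightarrow> f x = 0" and "f z \<noteq> 0"
  shows "(\<Sum>x\<in>K. P f x * f x) > 0"
proof -
  have "{x. f x \<noteq> 0} \<subseteq> K"
    using assms(2) by blast
  then have "f \<in> C0"
    using assms(1) by (auto simp: C0_def intro: finite_subset)
  moreover have "f \<noteq> (\<lambda>_. 0)"
    using assms(3) by auto
  ultimately have "l2_inner (\<lambda>_. 1) (P f) f > 0"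
    using form_pos by blast
  then show ?thesis
    using l2_inner_finite[OF assms(1,2)] by simp
qed

section \<open>The Dirichlet problem on finite sets\<close>

lemma P_indicator_nonpos: "x \<notin> S \<Longrightarrow> P (indicator S) x \<le> 0"
  by (rule P_nonpos) (auto simp: indicator_def)

text \<open>Gaussian elimination. Positivity of the form makes each pivot positive, and the signs
  off the diagonal keep all data nonnegative, as for the inverse of an M-matrix.\<close>

lemma Dirichlet_problem:
  assumes "finite K" and "\<And>x. x \<in> K \<Longrightarrow> g x \<ge> 0"
  shows "\<exists>u. (\<forall>x. u x \<ge> 0) \<and> (\<forall>x. x \<notin> K \<longrightarrow> u x = 0) \<and> (\<forall>x\<in>K. P u x = g x)"
  using assms
proof (induction K arbitrary: g rule: finite_induct)
  case empty
  show ?case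
    by (rule exI[of _ "\<lambda>_. 0"]) simp
next
  case (insert z K)
  obtain w where w: "\<And>x. w x \<ge> 0" "\<And>x. x \<notin> K \<Longrightarrow> w x = 0" "\<And>x. x \<in> K \<Longrightarrow> P w x = g x"
    using insert.IH[of g] insert.prems by (metis insertI2)
  \<comment> \<open>These data extend the value 1 at \<open>z\<close> to a function \<open>v\<close>
    with \<open>P v = 0\<close> on \<open>K\<close>; adding multiples of \<open>v\<close> preserves
    the equations on \<open>K\<close>.\<close>
  have "- P (indicator {z}) x \<ge> 0" if "x \<in> K" for x
    using P_indicator_nonpos[of x "{z}"] insert.hyps that by fastforce
  from insert.IH[of "\<lambda>x. - P (indicator {z}) x", OF this]
  obtain h where h: "\<And>x. h x \<ge> 0" "\<And>x. x \<notin> K \<Longrightarrow> h x = 0"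
      "\<And>x. x \<in> K \<Longrightarrow> P h x = - P (indicator {z}) x"
    by auto
  define v where "v = (\<lambda>x. h x + indicator {z} x)"
  have v: "\<And>x. v x \<ge> 0" "\<And>x. x \<notin> insert z K \<Longrightarrow> v x = 0" "v z = 1"
    using h(1,2) insert.hyps by (auto simp: v_def indicator_def)
  have Pv: "P v x = 0" if "x \<in> K" for x
    using h(3)[OF that] unfolding v_def P_add by simp
  \<comment> \<open>Only the term at \<open>z\<close> survives, so the form of \<open>v\<close> is
    the pivot \<open>P v z\<close>.\<close>
  have "(\<Sum>x\<in>insert z K. P v x * v x) > 0"
    by (rule P_form_pos[where z = z]) (use insert.hyps v in auto)
  then have Pvz: "P v z > 0"
    using insert.hyps v(3) Pv by simp
  have "P w z \<le> 0"
    by (rule P_nonpos) (use w insert.hyps in auto)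
  \<comment> \<open>The coefficient that makes \<open>P (w + t v) = g\<close> at
    \<open>z\<close>.\<close>
  define t where "t = (g z - P w z) / P v z"
  have "t \<ge> 0"
    using \<open>P w z \<le> 0\<close> Pvz insert.prems[of z] by (simp add: t_def)
  define u where "u = (\<lambda>x. w x + t * v x)"
  have Pu: "P u x = P w x + t * P v x" for x
    unfolding u_def P_add P_scale ..
  have "P u x = g x" if "x \<in> insert z K" for x
    using that Pvz w(3) Pv by (auto simp: Pu t_def)
  moreover have "u x \<ge> 0" for x
    using w(1) v(1) \<open>t \<ge> 0\<close> by (simp add: u_def)
  moreover have "u x = 0" if "x \<notin> insert z K" for x
    using that w(2) v(2) by (simp add: u_def)
  ultimately show ?case
    by blast
qed

section \<open>Harnack inequalities and strict positivity\<close>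

lemma diag_pos: "diag x > 0"
proof -
  have "(\<Sum>y\<in>{x}. P (indicator {x}) y * indicator {x} y) > 0"
    by (rule P_form_pos[where z = x]) (auto simp: indicator_def)
  moreover have "(\<Sum>y\<in>neighbours E x. a {x, y} * indicator {x} y) = 0"
    by (rule sum.neutral) (use not_loop[OF edges] in \<open>auto simp: neighbours_def indicator_def\<close>)
  ultimately show ?thesis
    by (simp add: P_eq)
qed

text \<open>The nonnegative terms \<open>a {x, y} * u y\<close> add up to
  \<open>diag x * u x\<close>, which bounds each of them.\<close>

lemma Harnack_neighbour:
  assumes "P u x = 0" and "\<And>x. u x \<ge> 0" and "y \<in> neighbours E x"
  shows "u y \<le> diag x / a {x, y} * u x"
proof -
  have "a {x, y} * u y \<le> (\<Sum>y\<in>neighbours E x. a {x, y} * u y)"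
    by (rule member_le_sum)
       (use assms in \<open>auto intro!: mult_nonneg_nonneg less_imp_le[OF a_edge_pos]\<close>)
  also have "\<dots> = diag x * u x"
    using assms(1) by (simp add: P_eq)
  finally show ?thesis
    using a_edge_pos[OF assms(3)] by (simp add: field_simps)
qed

text \<open>The neighbour bound is chained along a path from \<open>x\<^sub>0\<close> to
  \<open>y\<close>; \<open>N\<close> collects the vertices where the equation is used. Both
  \<open>N\<close> and \<open>C\<close> are independent of \<open>u\<close>, which makes the bound
  uniform over local solutions.\<close>

lemma Harnack:
  "\<exists>N C. finite N \<and> C \<ge> 0 \<and> (\<forall>u. (\<forall>x. u x \<ge> 0) \<longrightarrow> (\<forall>x\<in>N. P u x = 0) \<longrightarrow> u y \<le> C * u x\<^sub>0)"
proof -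
  let ?S = "{y. \<exists>N C. finite N \<and> C \<ge> 0 \<and>
    (\<forall>u. (\<forall>x. u x \<ge> 0) \<longrightarrow> (\<forall>x\<in>N. P u x = 0) \<longrightarrow> u y \<le> C * u x\<^sub>0)}"
  have "y \<in> ?S"
  proof (rule connected_closed_mem[OF conn])
    show "x\<^sub>0 \<in> ?S"
      by (auto intro!: exI[of _ "{}"] exI[of _ 1])
  next
    fix x assume "x \<in> ?S"
    then obtain N C where NC: "finite N" "C \<ge> 0"
        "\<And>u. \<forall>x. u x \<ge> 0 \<Longrightarrow> \<forall>x\<in>N. P u x = 0 \<Longrightarrow> u x \<le> C * u x\<^sub>0"
      by auto
    show "neighbours E x \<subseteq> ?S"
    proof
      fix y assume y: "y \<in> neighbours E x"
      have r: "diag x / a {x, y} \<ge> 0"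
        using a_edge_pos[OF y] diag_pos[of x] by simp
      have "u y \<le> (diag x / a {x, y} * C) * u x\<^sub>0"
        if u: "\<forall>x. u x \<ge> 0" "\<forall>z\<in>insert x N. P u z = 0" for u
      proof -
        have "u y \<le> diag x / a {x, y} * u x"
          by (rule Harnack_neighbour) (use u y in auto)
        also have "\<dots> \<le> diag x / a {x, y} * (C * u x\<^sub>0)"
          by (rule mult_left_mono) (use NC u r in auto)
        finally show ?thesis
          by (simp only: mult.assoc)
      qed
      moreover have "diag x / a {x, y} * C \<ge> 0"
        using r NC(2) by (rule mult_nonneg_nonneg)
      ultimately show "y \<in> ?S"
        using NC(1) unfolding mem_Collect_eq
        by (intro exI[of _ "insert x N"] exI[of _ "diag x / a {x, y} * C"]) auto
    qed
  qed
  then show ?thesis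
    unfolding mem_Collect_eq .
qed

text \<open>A minimum principle: by the neighbour bound, a zero forces zeros at all neighbours.
  Asking for the equation only at zeros covers functions that solve it just on a finite set and
  equal 1 elsewhere.\<close>

lemma harmonic_pos:
  assumes "\<And>x. u x \<ge> 0" and "\<And>x. u x = 0 \<Longrightarrow> P u x = 0" and "u x\<^sub>1 > 0"
  shows "u x > 0"
proof (rule ccontr)
  assume "\<not> u x > 0"
  then have "u x = 0"
    using assms(1)[of x] by simp
  have "x\<^sub>1 \<in> {x. u x = 0}"
  proof (rule connected_closed_mem[OF conn])
    show "x \<in> {x. u x = 0}"
      using \<open>u x = 0\<close> by simp
  next
    fix y assume y: "y \<in> {x. u x = 0}"
    show "neighbours E y \<subseteq> {x. u x = 0}"
    proof
      fix z assume "z \<in> neighbours E y"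
      then have "u z \<le> diag y / a {y, z} * u y"
        using y assms(1,2) by (intro Harnack_neighbour) auto
      with y assms(1)[of z] show "z \<in> {x. u x = 0}"
        by simp
    qed
  qed
  with assms(3) show False
    by simp
qed

section \<open>From local solutions to a global positive solution\<close>

lemma local_solution:
  assumes "finite K"
  obtains u where "\<And>x. u x > 0" and "u x\<^sub>0 = 1" and "\<And>x. x \<in> K \<Longrightarrow> P u x = 0"
proof -
  \<comment> \<open>The boundary value 1 off \<open>K\<close> is moved to the right-hand
    side.\<close>
  have "- P (indicator (- K)) x \<ge> 0" if "x \<in> K" for x
    using P_indicator_nonpos[of x "- K"] that by simp
  from Dirichlet_problem[of K "\<lambda>x. - P (indicator (- K)) x", OF assms this]
  obtain h where h: "\<And>x. h x \<ge> 0" "\<And>x. x \<notin> K \<Longrightarrow> h x = 0"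
      "\<And>x. x \<in> K \<Longrightarrow> P h x = - P (indicator (- K)) x"
    by auto
  define v where "v = (\<lambda>x. h x + indicator (- K) x)"
  have Pv: "P v x = 0" if "x \<in> K" for x
    using h(3)[OF that] unfolding v_def P_add by simp
  have v0: "v x \<ge> 0" for x
    using h(1) by (simp add: v_def)
  have v1: "v x = 1" if "x \<notin> K" for x
    using that h(2) by (simp add: v_def)
  \<comment> \<open>Infinitude of the graph provides a vertex where \<open>v = 1\<close>, so
    \<open>v\<close> is not identically zero.\<close>
  obtain x\<^sub>1 where "x\<^sub>1 \<notin> K"
    using infinite_V assms ex_new_if_finite by blast
  have pos: "v x > 0" for x
  proof (rule harmonic_pos[OF v0])
    show "P v x = 0" if "v x = 0" for x
      using that v1[of x] Pv[of x] by auto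
    show "v x\<^sub>1 > 0"
      using v1[OF \<open>x\<^sub>1 \<notin> K\<close>] by simp
  qed
  then have "v x\<^sub>0 \<noteq> 0"
    using less_irrefl by metis
  show ?thesis
  proof (rule that[of "\<lambda>x. 1 / v x\<^sub>0 * v x"])
    show "P (\<lambda>x. 1 / v x\<^sub>0 * v x) x = 0" if "x \<in> K" for x
      unfolding P_scale Pv[OF that] by simp
  qed (use pos \<open>v x\<^sub>0 \<noteq> 0\<close> in simp_all)
qed

text \<open>In the product topology this holds because \<open>P u x\<close> involves only finitely
  many coordinates of \<open>u\<close>.\<close>

lemma continuous_on_P: "continuous_on UNIV (\<lambda>u. P u x)"
  unfolding P_eq by (intro continuous_on_diff continuous_on_mult continuous_on_sum continuous_on_const
      continuous_on_product_coordinates)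

lemma harmonic_exists:
  obtains \<phi> where "\<And>x. \<phi> x > 0" and "\<And>x. P \<phi> x = 0"
proof -
  fix x\<^sub>0 :: 'v
  obtain N C where N: "\<And>y. finite (N y)" and C: "\<And>y. C y \<ge> 0"
    and NC: "\<And>y u. \<forall>x. u x \<ge> 0 \<Longrightarrow> \<forall>x\<in>N y. P u x = 0 \<Longrightarrow> u y \<le> C y * u x\<^sub>0"
    using Harnack[of _ x\<^sub>0] by metis
  \<comment> \<open>The box is compact by Tychonoff; a point of it lying in all the closed sets
    \<open>F x\<close> is the desired solution, found by the finite intersection property.\<close>
  define B where "B = PiE UNIV (\<lambda>y. {0..C y})"
  define F where "F = (\<lambda>x. {u. u x\<^sub>0 = 1 \<and> P u x = 0})"
  have "compactin (product_topology (\<lambda>_. euclidean) UNIV) B"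
    unfolding B_def by (subst compactin_PiE) auto
  then have "compact B"
    by (simp add: euclidean_product_topology)
  moreover have "closed (F x)" for x
    unfolding F_def
    by (intro closed_Collect_conj closed_Collect_eq continuous_on_P continuous_on_const
        continuous_on_product_coordinates)
  moreover have "B \<inter> (\<Inter>x\<in>K. F x) \<noteq> {}" if "finite K" for K
  proof -
    \<comment> \<open>All coordinates that enter the conditions \<open>F x\<close> for
      \<open>x \<in> K\<close>.\<close>
    define K' where "K' = insert x\<^sub>0 (K \<union> (\<Union>x\<in>K. neighbours E x))"
    have "finite (K \<union> (\<Union>y\<in>K'. N y))"
      using that N by (simp add: K'_def)
    then obtain u where u: "\<And>x. u x > 0" "u x\<^sub>0 = 1"
        "\<And>x. x \<in> K \<union> (\<Union>y\<in>K'. N y) \<Longrightarrow> P u x = 0"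
      by (rule local_solution[of _ x\<^sub>0]) blast
    have uC: "u y \<le> C y" if "y \<in> K'" for y
      using NC[of u y] u that by (auto simp: less_imp_le)
    \<comment> \<open>The bounds on \<open>u\<close> are secured only on \<open>K'\<close>; cutting
      off outside puts \<open>v\<close> into \<open>B\<close> without changing \<open>P u\<close> on
      \<open>K\<close>.\<close>
    define v where "v = (\<lambda>x. if x \<in> K' then u x else 0)"
    have "v \<in> B"
      using uC C u(1) by (auto simp: B_def v_def less_imp_le)
    moreover have "v \<in> F x" if "x \<in> K" for x
    proof -
      have "P v x = P u x"
        unfolding P_eq using that by (auto simp: v_def K'_def intro!: sum.cong)
      then show ?thesis
        using that u(2,3) by (simp add: F_def v_def K'_def)
    qed
    ultimately show ?thesis
      by blast
  qed
  ultimately have "B \<inter> (\<Inter>x. F x) \<noteq> {}"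
    by (rule compact_imp_fip_image)
  then obtain \<phi> where \<phi>: "\<phi> \<in> B" "\<And>x. \<phi> \<in> F x"
    by blast
  show ?thesis
  proof (rule that)
    show P0: "P \<phi> x = 0" for x
      using \<phi>(2) by (simp add: F_def)
    \<comment> \<open>Membership in \<open>B\<close> gives only \<open>\<phi> \<ge> 0\<close>; the
      normalisation at \<open>x\<^sub>0\<close> excludes the zero function.\<close>
    show "\<phi> x > 0" for x
      by (rule harmonic_pos[where x\<^sub>1 = x\<^sub>0]) (use \<phi> P0 in \<open>auto simp: B_def F_def\<close>)
  qed
qed

section \<open>The ground state transform and unitary equivalence\<close>

lemma ground_state_transform:
  assumes "\<And>x. \<phi> x > 0" and "P \<phi> x = 0"
  shows "weighted_laplacian E \<phi> (\<lambda>e. a e * (\<Prod>z\<in>e. \<phi> z)) (\<lambda>x. f x / \<phi> x) x = P f x / \<phi> x"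
proof -
  have nz: "\<phi> x \<noteq> 0" for x
    using assms(1)[of x] by simp
  have harm: "(\<Sum>y\<in>neighbours E x. a {x, y} * \<phi> y) = diag x * \<phi> x"
    using assms(2) by (simp add: P_eq)
  have "(\<Sum>y\<in>neighbours E x. a {x, y} * (\<Prod>z\<in>{x, y}. \<phi> z) * (f x / \<phi> x - f y / \<phi> y)) =
      (\<Sum>y\<in>neighbours E x. f x * (a {x, y} * \<phi> y) - \<phi> x * (a {x, y} * f y))"
  proof (rule sum.cong[OF refl])
    \<comment> \<open>Without loops the edge has two elements, so the product over it is
      \<open>\<phi> x * \<phi> y\<close>.\<close>
    fix y assume "y \<in> neighbours E x"
    then have "x \<noteq> y"
      using not_loop[OF edges] by (auto simp: neighbours_def)
    then show "a {x, y} * (\<Prod>z\<in>{x, y}. \<phi> z) * (f x / \<phi> x - f y / \<phi> y) =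
        f x * (a {x, y} * \<phi> y) - \<phi> x * (a {x, y} * f y)"
      using nz by (simp add: right_diff_distrib)
  qed
  \<comment> \<open>The equation for \<open>\<phi>\<close> turns the neighbour sum into the diagonal
    term, which restores the potential \<open>W\<close>.\<close>
  also have "\<dots> = f x * (diag x * \<phi> x) - \<phi> x * (\<Sum>y\<in>neighbours E x. a {x, y} * f y)"
    by (simp add: sum_subtractf sum_distrib_left flip: harm)
  also have "\<dots> = \<phi> x * P f x"
    by (simp add: P_eq algebra_simps)
  finally show ?thesis
    using nz[of x] by (simp add: weighted_laplacian_def power2_eq_square)
qed

end

theorem theorem5p1:
  fixes E :: "'v set set" and a :: "'v set \<Rightarrow> real" and W :: "'v \<Rightarrow> real"
  assumes "graph_edges E"
    and "infinite (UNIV :: 'v set)"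
    and "graph_connected E"
    and "graph_locally_finite E"
    and "\<forall>e\<in>E. a e > 0"
    and "\<forall>f\<in>C0 - {\<lambda>_. 0}. l2_inner (\<lambda>_. 1) (schroedinger E a W f) f > 0"
  shows "\<exists>(\<omega> :: 'v \<Rightarrow> real) (c :: 'v set \<Rightarrow> real).
           (\<forall>x. \<omega> x > 0) \<and> (\<forall>e\<in>E. c e > 0) \<and>
           unitarily_equivalent (\<lambda>_. 1) (schroedinger E a W) \<omega> (weighted_laplacian E \<omega> c)"
proof -
  interpret positive_schroedinger E a W
    by standard (use assms in auto)
  obtain \<phi> where \<phi>: "\<And>x. \<phi> x > 0" "\<And>x. P \<phi> x = 0"
    by (rule harmonic_exists) blast
  define c where "c = (\<lambda>e. a e * (\<Prod>z\<in>e. \<phi> z))"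
  define U where "U = (\<lambda>(f :: 'v \<Rightarrow> real) x. f x / \<phi> x)"
  have nz: "\<phi> x \<noteq> 0" for x
    using \<phi>(1)[of x] by simp
  have unitary: "unitary_map (\<lambda>_. 1) \<phi> U"
    unfolding U_def by (rule unitary_map_divide) (rule \<phi>(1))
  have "U ` C0 = C0"
  proof
    show "U ` C0 \<subseteq> C0"
      using nz by (auto simp: U_def C0_def)
    show "C0 \<subseteq> U ` C0"
    proof
      fix f :: "'v \<Rightarrow> real" assume "f \<in> C0"
      then have "(\<lambda>x. \<phi> x * f x) \<in> C0"
        using nz by (simp add: C0_def)
      moreover have "f = U (\<lambda>x. \<phi> x * f x)"
        using nz by (simp add: U_def)
      ultimately show "f \<in> U ` C0"
        by blast
    qed
  qed
  moreover have "P f = inv_into (l2 (\<lambda>_. 1)) U (weighted_laplacian E \<phi> c (U f))" if "f \<in> C0" for f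
  proof -
    have "weighted_laplacian E \<phi> c (U f) = U (P f)"
      unfolding U_def c_def using ground_state_transform[OF \<phi>] by blast
    moreover have "inj_on U (l2 (\<lambda>_. 1))"
      using unitary by (simp add: unitary_map_def bij_betw_def)
    \<comment> \<open>\<open>inv_into\<close> is sure to undo \<open>U\<close> only on images of
      elements of this space.\<close>
    moreover have "P f \<in> l2 (\<lambda>_. 1)"
      using P_C0[OF that] C0_subset_l2 by blast
    ultimately show ?thesis
      by simp
  qed
  ultimately have "unitarily_equivalent (\<lambda>_. 1) P \<phi> (weighted_laplacian E \<phi> c)"
    using unitary unfolding unitarily_equivalent_def by blast
  moreover have "\<forall>e\<in>E. c e > 0"
    using \<phi>(1) a_pos by (simp add: c_def prod_pos)
  ultimately show ?thesis
    using \<phi>(1) by blast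
qed

end
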